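(* Let $p\in[1,\infty]$, let $n\ge 1$, and let $f(z)=\sum_\alpha a_\alpha z^\alpha+\sum_\alpha\overline{b}_\alpha\overline{z}^\alpha$ be a complex-valued pluriharmonic function on $\mathbb{B}_{\ell_p^n}$ with $\sup_{z\in\mathbb{B}_{\ell_p^n}}\mathrm{Re}(f(z))\leq 1$. Then for all $k\in\{1,2,\ldots\}$, $$\sup_{z\in\mathbb{B}_{\ell_p^n}}\left|\sum_{|\alpha|=k}(a_\alpha+b_\alpha)z^\alpha\right|\leq 2\big(1-\mathrm{Re}(f(0))\big),$$ and for all multi-indices $\alpha$ with $|\alpha|\geq 1$, $$|a_\alpha+b_\alpha|\leq 2\left(\frac{|\alpha|^{|\alpha|}}{\alpha^\alpha}\right)^{\frac1p}\big(1-\mathrm{Re}(f(0))\big).$$ Moreover, the constant $2$ in each of these two inequalities is sharp (it cannot be replaced by a smaller constant).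
   Context: For $p\in[1,\infty)$, $\|z\|_p=(\sum_j|z_j|^p)^{1/p}$, and $\|z\|_\infty=\max_j|z_j|$; $\mathbb{B}_{\ell_p^n}=\{z\in\mathbb{C}^n:\|z\|_p<1\}$. Multi-indices $\alpha=(\alpha_1,\dots,\alpha_n)$ consist of nonnegative integers; $|\alpha|=\sum_k\alpha_k$, $z^\alpha=\prod_k z_k^{\alpha_k}$, $\alpha^\alpha=\prod_k\alpha_k^{\alpha_k}$ with $0^0=1$; $1/p=0$ when $p=\infty$. A twice continuously differentiable complex-valued function $f$ on a domain $\Omega\subset\mathbb{C}^n$ is pluriharmonic if for each fixed $z\in\Omega$ and $\theta\in\mathbb{C}^n$ with $\|\theta\|_2=1$, the function $\zeta\mapsto f(z+\zeta\theta)$ is harmonic in $\{|\zeta|<d_\Omega(z)\}$, where $d_\Omega(z)$ is the Euclidean distance from $z$ to $\partial\Omega$. On $\mathbb{B}_{\ell_p^n}$ such an $f$ has the form $f=h+\overline g$ with $h,g$ holomorphic, and the displayed expansion means $h=\sum_\alpha a_\alpha z^\alpha$, $g=\sum_\alpha b_\alpha z^\alpha$. *)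

theory Defs
  imports "HOL-Analysis.Analysis"
begin

text \<open>
  Complex \<open>n\<close>-space is \<open>complex ^ 'n\<close>. Its library \<open>norm\<close> and \<open>dist\<close> are the Euclidean ones,
  and \<open>*s\<close> is multiplication by complex scalars. Multi-indices are functions \<open>'n \<Rightarrow> nat\<close>.
\<close>

definition lp_norm :: "ereal \<Rightarrow> complex ^ 'n \<Rightarrow> real" where
  "lp_norm p z =
     (if p = \<infinity> then Max (range (\<lambda>j. norm (z $ j)))
      else (\<Sum>j\<in>UNIV. norm (z $ j) powr real_of_ereal p) powr (1 / real_of_ereal p))"

definition lp_ball :: "ereal \<Rightarrow> (complex ^ 'n) set" where
  "lp_ball p = {z. lp_norm p z < 1}"

definition mi_size :: "('n::finite \<Rightarrow> nat) \<Rightarrow> nat" where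
  "mi_size \<alpha> = (\<Sum>k\<in>UNIV. \<alpha> k)"

definition mi_monom :: "complex ^ 'n \<Rightarrow> ('n \<Rightarrow> nat) \<Rightarrow> complex" where
  "mi_monom z \<alpha> = (\<Prod>k\<in>UNIV. (z $ k) ^ \<alpha> k)"

definition mi_self_power :: "('n::finite \<Rightarrow> nat) \<Rightarrow> nat" where
  "mi_self_power \<alpha> = (\<Prod>k\<in>UNIV. \<alpha> k ^ \<alpha> k)"

text \<open>
  \<open>f'\<close> and \<open>f''\<close> are the first and second real Frechet derivatives of \<open>f\<close> on the (open) set
  \<open>U\<close>, and the second one is continuous there.
\<close>

definition has_C2_derivs_on ::
    "'a::real_normed_vector set \<Rightarrow> ('a \<Rightarrow> 'b::real_normed_vector)
      \<Rightarrow> ('a \<Rightarrow> 'a \<Rightarrow>\<^sub>L 'b) \<Rightarrow> ('a \<Rightarrow> 'a \<Rightarrow>\<^sub>L 'a \<Rightarrow>\<^sub>L 'b) \<Rightarrow> bool" where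
  "has_C2_derivs_on U f f' f'' \<longleftrightarrow>
     (\<forall>x\<in>U. (f has_derivative blinfun_apply (f' x)) (at x)) \<and>
     (\<forall>x\<in>U. (f' has_derivative blinfun_apply (f'' x)) (at x)) \<and>
     continuous_on U f''"

definition C2_on :: "'a::real_normed_vector set \<Rightarrow> ('a \<Rightarrow> 'b::real_normed_vector) \<Rightarrow> bool" where
  "C2_on U f \<longleftrightarrow> (\<exists>f' f''. has_C2_derivs_on U f f' f'')"

text \<open>
  The sum is the Laplacian; for functions of one complex variable \<open>Basis = {1, \<i>}\<close>.
\<close>

definition harmonic_on ::
    "'a::euclidean_space set \<Rightarrow> ('a \<Rightarrow> 'b::real_normed_vector) \<Rightarrow> bool" where
  "harmonic_on U u \<longleftrightarrow>
     (\<exists>u' u''. has_C2_derivs_on U u u' u'' \<and>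
        (\<forall>x\<in>U. (\<Sum>e\<in>Basis. blinfun_apply (blinfun_apply (u'' x) e) e) = 0))"

text \<open>
  Taking the infimum in \<open>ereal\<close> makes the distance infinite when the boundary is empty.
\<close>

definition boundary_dist :: "'a::metric_space set \<Rightarrow> 'a \<Rightarrow> ereal" where
  "boundary_dist \<Omega> z = (INF w\<in>frontier \<Omega>. ereal (dist z w))"

definition pluriharmonic_on :: "(complex ^ 'n) set \<Rightarrow> (complex ^ 'n \<Rightarrow> complex) \<Rightarrow> bool" where
  "pluriharmonic_on \<Omega> f \<longleftrightarrow>
     C2_on \<Omega> f \<and>
     (\<forall>z\<in>\<Omega>. \<forall>\<theta>. norm \<theta> = 1 \<longrightarrow>
        harmonic_on {\<zeta>. ereal (norm \<zeta>) < boundary_dist \<Omega> z} (\<lambda>\<zeta>. f (z + \<zeta> *s \<theta>)))"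

definition holomorphic_Cn_on :: "(complex ^ 'n) set \<Rightarrow> (complex ^ 'n \<Rightarrow> complex) \<Rightarrow> bool" where
  "holomorphic_Cn_on \<Omega> h \<longleftrightarrow>
     (\<forall>z\<in>\<Omega>. \<exists>D. (h has_derivative D) (at z) \<and> (\<forall>c v. D (c *s v) = c * D v))"

text \<open>
  The expansion \<open>f(z) = \<Sum> a\<^sub>\<alpha> z\<^sup>\<alpha> + \<Sum> cnj(b\<^sub>\<alpha> z\<^sup>\<alpha>)\<close>. As usual for power series in several
  variables, the sums over multi-indices are unordered.
\<close>

definition has_pluriharmonic_expansion_on ::
    "(complex ^ 'n) set \<Rightarrow> (complex ^ 'n \<Rightarrow> complex)
      \<Rightarrow> (('n \<Rightarrow> nat) \<Rightarrow> complex) \<Rightarrow> (('n \<Rightarrow> nat) \<Rightarrow> complex) \<Rightarrow> bool" where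
  "has_pluriharmonic_expansion_on \<Omega> f a b \<longleftrightarrow>
     (\<exists>h g. holomorphic_Cn_on \<Omega> h \<and> holomorphic_Cn_on \<Omega> g \<and>
        (\<forall>z\<in>\<Omega>. f z = h z + cnj (g z)) \<and>
        (\<forall>z\<in>\<Omega>. ((\<lambda>\<alpha>. a \<alpha> * mi_monom z \<alpha>) has_sum h z) UNIV) \<and>
        (\<forall>z\<in>\<Omega>. ((\<lambda>\<alpha>. b \<alpha> * mi_monom z \<alpha>) has_sum g z) UNIV))"

text \<open>
  The standing hypotheses on \<open>f\<close>. The supremum is taken in \<open>ereal\<close> because a real-valued
  \<open>SUP\<close> is meaningless on sets that are unbounded above.
\<close>

definition admissible ::
    "ereal \<Rightarrow> (complex ^ 'n \<Rightarrow> complex)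
      \<Rightarrow> (('n \<Rightarrow> nat) \<Rightarrow> complex) \<Rightarrow> (('n \<Rightarrow> nat) \<Rightarrow> complex) \<Rightarrow> bool" where
  "admissible p f a b \<longleftrightarrow>
     pluriharmonic_on (lp_ball p) f \<and>
     has_pluriharmonic_expansion_on (lp_ball p) f a b \<and>
     (SUP z\<in>lp_ball p. ereal (Re (f z))) \<le> 1"

text \<open>
  The two inequalities with a constant \<open>C\<close> in place of 2. In \<open>ereal\<close>, \<open>1 / \<infinity> = 0\<close>.
\<close>

definition homogeneous_bound ::
    "real \<Rightarrow> ereal \<Rightarrow> nat \<Rightarrow> (complex ^ 'n \<Rightarrow> complex)
      \<Rightarrow> (('n \<Rightarrow> nat) \<Rightarrow> complex) \<Rightarrow> (('n \<Rightarrow> nat) \<Rightarrow> complex) \<Rightarrow> bool" where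
  "homogeneous_bound C p k f a b \<longleftrightarrow>
     (SUP z\<in>lp_ball p. ereal (norm (\<Sum>\<alpha>\<in>{\<alpha>. mi_size \<alpha> = k}. (a \<alpha> + b \<alpha>) * mi_monom z \<alpha>)))
       \<le> ereal (C * (1 - Re (f 0)))"

definition coefficient_bound ::
    "real \<Rightarrow> ereal \<Rightarrow> ('n \<Rightarrow> nat) \<Rightarrow> (complex ^ 'n \<Rightarrow> complex)
      \<Rightarrow> (('n \<Rightarrow> nat) \<Rightarrow> complex) \<Rightarrow> (('n \<Rightarrow> nat) \<Rightarrow> complex) \<Rightarrow> bool" where
  "coefficient_bound C p \<alpha> f a b \<longleftrightarrow>
     norm (a \<alpha> + b \<alpha>)
       \<le> C * (real (mi_size \<alpha> ^ mi_size \<alpha>) / real (mi_self_power \<alpha>)) powr real_of_ereal (1 / p)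
           * (1 - Re (f 0))"

end

theory Submission
  imports Defs
begin

text \<open>
  A bound on the real part of \<open>f = h + cnj g\<close> is a bound on the real part of the holomorphic function
  \<open>h + g\<close>, whose power series has the coefficients \<open>a \<alpha> + b \<alpha>\<close>. Restricting \<open>h + g\<close> to the
  complex line through \<open>0\<close> and a point \<open>z\<close> of the ball gives a power series in one variable whose
  \<open>k\<close>-th coefficient is the \<open>k\<close>-homogeneous part at \<open>z\<close>. Caratheodory's inequality for functions with
  real part at most \<open>1\<close> on the disc (\<open>caratheodory_coefficient_bound\<close>) is then the first estimate
  (\<open>norm_hom_part_le\<close>).

  For a single coefficient, Cauchy's estimate on a torus (\<open>torus_coefficient_bound\<close>) bounds
  \<open>norm (a \<alpha> + b \<alpha>) * norm (mi_monom z \<alpha>)\<close> by the same quantity for each \<open>z\<close> in the ball. The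
  supremum of \<open>norm (mi_monom z \<alpha>)\<close> over the ball is the reciprocal of
  \<open>(|\<alpha>| ^ |\<alpha>| / \<alpha> ^ \<alpha>) powr (1 / p)\<close>: the weighted inequality of the arithmetic and geometric means
  is the upper bound (\<open>monomial_const_mult_norm_less_1\<close>), and its equality case gives points at
  which it is approached (\<open>lp_ball_extremal_point\<close>).

  Both constants are sharp because \<open>w \<mapsto> - 2 * w / (1 - w) = 1 - (1 + w) / (1 - w)\<close> has real part below
  \<open>1\<close> on the disc, vanishes at \<open>0\<close> and has first coefficient \<open>- 2\<close>. Composed with the monomial
  \<open>mi_monom z \<alpha>\<close>, scaled to have supremum \<open>1\<close> on the ball, it attains the coefficient bound for \<open>\<alpha>\<close>
  and the homogeneous bound for \<open>|\<alpha>|\<close>. To see that it is pluriharmonic, it is placed in a class of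
  rational functions that is closed under directional derivatives (\<open>rational_on_imp_pluriharmonic_on\<close>).

  All mean values are taken over roots of unity: the functions averaged are polynomials, so finite
  means are exact and play the role of integrals over circles and tori.
\<close>

section \<open>Caratheodory's coefficient inequality\<close>

lemma sum_powers_root_of_unity:
  assumes N: "N > 0"
  shows "(\<Sum>y<N. (cis (2 * pi / real N) ^ y) ^ m) = (if N dvd m then of_nat N else 0)"
proof -
  define w where "w = cis (2 * pi / real N) ^ m"
  have w: "w = exp (2 * of_real pi * \<i> * of_nat m / of_nat N)"
    by (simp add: w_def cis_conv_exp exp_of_nat_mult[symmetric] mult_ac)
  have "w = 1 \<longleftrightarrow> N dvd m"
    unfolding w using complex_root_unity_eq_1[of N m] N by simp
  moreover have "w ^ N = 1"
  proof -
    have "w ^ N = (cis (2 * pi / real N) ^ N) ^ m"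
      by (simp add: w_def power_mult[symmetric] mult.commute)
    also have "cis (2 * pi / real N) ^ N = 1"
      using N by (simp add: Complex.DeMoivre)
    finally show ?thesis by simp
  qed
  moreover have "(\<Sum>y<N. (cis (2 * pi / real N) ^ y) ^ m) = (\<Sum>y<N. w ^ y)"
    by (simp add: w_def power_mult[symmetric] mult.commute)
  ultimately show ?thesis
    using geometric_sum[of w N] by auto
qed

text \<open>
  Sampling at the \<open>N\<close>-th roots of unity and averaging against \<open>\<zeta>\<^sup>l\<close> plays the role of a Fourier
  coefficient integral. The congruence \<open>N dvd m + l\<close> describes the aliasing; for \<open>N\<close> larger than
  every exponent that occurs it selects at most one coefficient.
\<close>
lemma average_polynomial_roots_of_unity:
  fixes q :: "nat \<Rightarrow> complex"
  assumes N: "N > 0"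
  defines "w \<equiv> cis (2 * pi / real N)"
  shows "(\<Sum>y<N. (\<Sum>m\<le>n. q m * (w ^ y) ^ m) * (w ^ y) ^ l)
           = of_nat N * (\<Sum>m | m \<le> n \<and> N dvd m + l. q m)"
proof -
  have "(\<Sum>y<N. (\<Sum>m\<le>n. q m * (w ^ y) ^ m) * (w ^ y) ^ l)
      = (\<Sum>y<N. \<Sum>m\<le>n. q m * (w ^ y) ^ (m + l))"
    by (simp add: sum_distrib_right power_add mult.assoc)
  also have "\<dots> = (\<Sum>m\<le>n. q m * (\<Sum>y<N. (w ^ y) ^ (m + l)))"
    by (subst sum.swap) (simp add: sum_distrib_left)
  also have "\<dots> = (\<Sum>m\<le>n. if N dvd m + l then of_nat N * q m else 0)"
    unfolding w_def by (intro sum.cong refl) (simp add: sum_powers_root_of_unity[OF N])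
  also have "\<dots> = of_nat N * (\<Sum>m | m \<le> n \<and> N dvd m + l. q m)"
    by (simp add: sum.If_cases sum_distrib_left Int_def)
  finally show ?thesis .
qed

text \<open>
  With \<open>R = B - Re Q \<ge> 0\<close> on the circle, the \<open>k\<close>-th Fourier coefficient of \<open>2 R = 2 B - Q - cnj Q\<close>
  is \<open>- q k\<close>, because \<open>cnj Q\<close> only has nonpositive frequencies. As \<open>R \<ge> 0\<close>, no Fourier coefficient
  of \<open>2 R\<close> exceeds in modulus its mean \<open>2 (B - Re (q 0))\<close>.
\<close>
lemma caratheodory_polynomial:
  fixes q :: "nat \<Rightarrow> complex"
  assumes k: "1 \<le> k" "k \<le> n"
    and Re_le: "\<And>\<zeta>. norm \<zeta> = 1 \<Longrightarrow> Re (\<Sum>m\<le>n. q m * \<zeta> ^ m) \<le> B"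
  shows "norm (q k) \<le> 2 * (B - Re (q 0))"
proof -
  \<comment> \<open>The frequencies involved lie between \<open>- n - k\<close> and \<open>n + k\<close>, so \<open>n + k + 1\<close> sample points
    make all averages below exact.\<close>
  define N where "N = Suc (n + k)"
  define w where "w = cis (2 * pi / real N)"
  define Q where "Q \<zeta> = (\<Sum>m\<le>n. q m * \<zeta> ^ m)" for \<zeta>
  have N: "N > 0" by (simp add: N_def)
  have nw: "norm (w ^ y) = 1" for y by (simp add: w_def norm_power)
  have wN: "(w ^ y) ^ N = 1" for y
  proof -
    have "w ^ N = 1" using N by (simp add: w_def Complex.DeMoivre)
    then show ?thesis by (metis mult.commute power_mult power_one)
  qed
  have cnj_w: "(w ^ y) ^ (N - k) = cnj ((w ^ y) ^ k)" for y
  proof -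
    have "(w ^ y) ^ (N - k) * (w ^ y) ^ k = 1"
    proof -
      have "N - k + k = N" using k by (simp add: N_def)
      then show ?thesis using wN[of y] by (metis power_add)
    qed
    moreover have "cnj ((w ^ y) ^ k) * (w ^ y) ^ k = 1"
      using nw[of y] by (metis complex_norm_square mult.commute norm_power of_real_1 power_one)
    ultimately show ?thesis
      by (metis mult_right_cancel mult_zero_right zero_neq_one)
  qed
  note avg = average_polynomial_roots_of_unity[OF N, of q n, folded w_def Q_def]
  have avg0: "(\<Sum>y<N. Q (w ^ y)) = of_nat N * q 0"
  proof -
    have "{m. m \<le> n \<and> N dvd m + 0} = {0}"
      using k by (auto simp: N_def dest: dvd_imp_le)
    then show ?thesis using avg[of 0] by simp
  qed
  have avgk: "(\<Sum>y<N. Q (w ^ y) * cnj ((w ^ y) ^ k)) = of_nat N * q k"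
  proof -
    have "m = k" if m: "m \<le> n" "N dvd m + (N - k)" for m
    proof -
      obtain d where d: "m + (N - k) = N * d" using m(2) by (elim dvdE)
      have "N * d < N * 2" "N * 0 < N * d"
        using d m(1) by (auto simp: N_def)
      then have "d = 1" by (simp only: mult_less_cancel1) simp
      then show ?thesis using d k by (simp add: N_def)
    qed
    moreover have "k + (N - k) = N" using k by (simp add: N_def)
    ultimately have "{m. m \<le> n \<and> N dvd m + (N - k)} = {k}"
      using k by auto
    then show ?thesis using avg[of "N - k"] by (simp add: cnj_w)
  qed
  have avg_conj: "(\<Sum>y<N. Q (w ^ y) * (w ^ y) ^ k) = 0"
  proof -
    have "{m. m \<le> n \<and> N dvd m + k} = {}"
      using k by (auto simp: N_def dest!: dvd_imp_le)
    then show ?thesis using avg[of k] by (simp only: sum.empty mult_zero_right)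
  qed
  have avg1: "(\<Sum>y<N. (w ^ y) ^ k) = 0"
  proof -
    have "\<not> N dvd k" using k by (auto simp: N_def dest!: dvd_imp_le)
    then show ?thesis
      using sum_powers_root_of_unity[OF N, of k, folded w_def] by simp
  qed
  define R where "R y = B - Re (Q (w ^ y))" for y
  have R: "R y \<ge> 0" for y using Re_le[OF nw] by (simp add: R_def Q_def)
  have "(\<Sum>y<N. of_real (2 * R y) * cnj ((w ^ y) ^ k))
      = (\<Sum>y<N. of_real (2 * B) * cnj ((w ^ y) ^ k) - Q (w ^ y) * cnj ((w ^ y) ^ k)
              - cnj (Q (w ^ y) * (w ^ y) ^ k))"
  proof (intro sum.cong refl)
    fix y
    have "of_real (2 * R y) = of_real (2 * B) - (Q (w ^ y) + cnj (Q (w ^ y)))"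
      unfolding complex_add_cnj R_def by simp
    then show "of_real (2 * R y) * cnj ((w ^ y) ^ k)
        = of_real (2 * B) * cnj ((w ^ y) ^ k) - Q (w ^ y) * cnj ((w ^ y) ^ k)
              - cnj (Q (w ^ y) * (w ^ y) ^ k)"
      by (simp only:) (simp add: algebra_simps)
  qed
  also have "\<dots> = - of_nat N * q k"
    unfolding sum_subtractf cnj_sum[symmetric] sum_distrib_left[symmetric] avgk avg_conj avg1
    by simp
  finally have "of_nat N * norm (q k) = norm (\<Sum>y<N. of_real (2 * R y) * cnj ((w ^ y) ^ k))"
    by (simp add: norm_mult)
  also have "\<dots> \<le> (\<Sum>y<N. 2 * R y)"
    using R by (intro sum_norm_le) (simp add: norm_mult norm_power nw[unfolded norm_power])
  also have "\<dots> = 2 * (N * B - Re (\<Sum>y<N. Q (w ^ y)))"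
    by (simp add: R_def sum_subtractf sum_distrib_left[symmetric])
  also have "\<dots> = of_nat N * (2 * (B - Re (q 0)))"
    by (simp add: avg0 algebra_simps)
  finally show ?thesis using N by (simp add: mult_le_cancel_left_pos)
qed

text \<open>
  The partial sums satisfy the polynomial bound with \<open>B\<close> enlarged by the tail of \<open>\<Sum> norm (c m)\<close>,
  which vanishes in the limit.
\<close>
lemma caratheodory_coefficient_bound:
  fixes c :: "nat \<Rightarrow> complex"
  assumes k: "1 \<le> k"
    and summ: "summable (\<lambda>m. norm (c m))"
    and Re_le: "\<And>\<zeta>. norm \<zeta> = 1 \<Longrightarrow> Re (\<Sum>m. c m * \<zeta> ^ m) \<le> B"
  shows "norm (c k) \<le> 2 * (B - Re (c 0))"
proof -
  define \<epsilon> where "\<epsilon> n = (\<Sum>m. norm (c (m + n)))" for n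
  have "norm (c k) \<le> 2 * (B + \<epsilon> (Suc n) - Re (c 0))" if "n \<ge> k" for n
  proof (rule caratheodory_polynomial[OF k that])
    fix \<zeta> :: complex assume z: "norm \<zeta> = 1"
    have nz: "norm (c m * \<zeta> ^ m) = norm (c m)" for m by (simp add: norm_mult norm_power z)
    have s: "summable (\<lambda>m. c m * \<zeta> ^ m)" by (rule summable_norm_cancel) (simp add: nz summ)
    have s': "summable (\<lambda>m. norm (c (m + Suc n)))" using summ by (rule summable_ignore_initial_segment)
    have "(\<Sum>m. c m * \<zeta> ^ m) = (\<Sum>m. c (m + Suc n) * \<zeta> ^ (m + Suc n)) + (\<Sum>m\<le>n. c m * \<zeta> ^ m)"
      using suminf_split_initial_segment[OF s, of "Suc n"] by (simp only: lessThan_Suc_atMost)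
    moreover have "norm (\<Sum>m. c (m + Suc n) * \<zeta> ^ (m + Suc n)) \<le> \<epsilon> (Suc n)"
      using summable_norm[of "\<lambda>m. c (m + Suc n) * \<zeta> ^ (m + Suc n)"] s'
      unfolding \<epsilon>_def nz by blast
    ultimately show "Re (\<Sum>m\<le>n. c m * \<zeta> ^ m) \<le> B + \<epsilon> (Suc n)"
      using Re_le[OF z] abs_Re_le_cmod[of "\<Sum>m. c (m + Suc n) * \<zeta> ^ (m + Suc n)"]
      by (simp only: plus_complex.sel)
  qed
  moreover have "(\<lambda>n. 2 * (B + \<epsilon> (Suc n) - Re (c 0))) \<longlonglongrightarrow> 2 * (B + 0 - Re (c 0))"
  proof -
    have "\<epsilon> \<longlonglongrightarrow> 0" unfolding \<epsilon>_def using summ by (rule suminf_exist_split2)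
    then show ?thesis by (intro tendsto_intros LIMSEQ_Suc)
  qed
  ultimately show ?thesis
    by (intro LIMSEQ_le_const[of _ "2 * (B - Re (c 0))"]) (auto intro!: exI[of _ k])
qed

section \<open>Monomials on the unit ball of an lp norm\<close>

lemma lp_exponent_cases:
  assumes "1 \<le> (p :: ereal)"
  obtains (infinite) "p = \<infinity>" | (finite) q where "p = ereal q" "1 \<le> q"
  using assms by (cases p) auto

lemma mem_lp_ball_infinite_iff: "z \<in> lp_ball \<infinity> \<longleftrightarrow> (\<forall>j. norm (z $ j) < 1)"
  by (simp add: lp_ball_def lp_norm_def)

lemma mem_lp_ball_finite_iff:
  assumes "1 \<le> q"
  shows "z \<in> lp_ball (ereal q) \<longleftrightarrow> (\<Sum>j\<in>UNIV. norm (z $ j) powr q) < 1"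
proof -
  let ?s = "\<Sum>j\<in>UNIV. norm (z $ j) powr q"
  have s: "?s \<ge> 0" by (intro sum_nonneg) auto
  have "?s powr (1 / q) < 1 \<longleftrightarrow> ?s < 1"
  proof
    assume "?s < 1"
    then show "?s powr (1 / q) < 1"
      using powr_less_mono2[of "1 / q" ?s 1] s assms by simp
  next
    assume *: "?s powr (1 / q) < 1"
    show "?s < 1"
    proof (rule ccontr)
      assume "\<not> ?s < 1"
      then have "?s powr (1 / q) \<ge> 1"
        using assms by (intro ge_one_powr_ge_zero) auto
      with * show False by simp
    qed
  qed
  then show ?thesis by (simp add: lp_ball_def lp_norm_def)
qed

text \<open>
  Being closed under coordinatewise decrease of moduli, the ball contains with \<open>z\<close> its dilations
  \<open>\<zeta> *s z\<close> for \<open>norm \<zeta> \<le> 1\<close> and all its coordinatewise rotations.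
\<close>
lemma lp_ball_dominated:
  assumes "1 \<le> p" "z \<in> lp_ball p" "\<And>j. norm (w $ j) \<le> norm (z $ j)"
  shows "w \<in> lp_ball p"
  using assms(1)
proof (cases rule: lp_exponent_cases)
  case infinite
  then show ?thesis
    using assms(2,3) by (auto simp: mem_lp_ball_infinite_iff intro: le_less_trans)
next
  case (finite q)
  have "(\<Sum>j\<in>UNIV. norm (w $ j) powr q) \<le> (\<Sum>j\<in>UNIV. norm (z $ j) powr q)"
    using assms(3) finite by (intro sum_mono powr_mono2) auto
  then show ?thesis
    using assms(2) finite by (simp add: mem_lp_ball_finite_iff)
qed

lemma finite_multi_indices_of_size: "finite {\<alpha> :: 'n::finite \<Rightarrow> nat. mi_size \<alpha> = m}"
proof (rule finite_subset)
  show "{\<alpha> :: 'n \<Rightarrow> nat. mi_size \<alpha> = m} \<subseteq> PiE UNIV (\<lambda>_. {..m})"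
    by (auto simp: mi_size_def intro!: member_le_sum)
qed (simp add: finite_PiE)

lemma mi_self_power_pos: "mi_self_power \<alpha> > 0"
  by (auto simp: mi_self_power_def intro!: prod_pos)

text \<open>
  For \<open>1 \<le> p\<close>, the reciprocal of the supremum of \<open>norm (mi_monom z \<alpha>)\<close> over the ball.
\<close>
definition monomial_const :: "ereal \<Rightarrow> ('n::finite \<Rightarrow> nat) \<Rightarrow> real" where
  "monomial_const p \<alpha> =
     (real (mi_size \<alpha> ^ mi_size \<alpha>) / real (mi_self_power \<alpha>)) powr real_of_ereal (1 / p)"

lemma monomial_const_pos: "mi_size \<alpha> \<ge> 1 \<Longrightarrow> monomial_const p \<alpha> > 0"
  using mi_self_power_pos[of \<alpha>] by (auto simp: monomial_const_def)

lemma norm_mi_monom: "norm (mi_monom z \<alpha>) = (\<Prod>j\<in>UNIV. norm (z $ j) ^ \<alpha> j)"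
  by (simp add: mi_monom_def norm_power flip: prod_norm)

text \<open>
  For finite exponent \<open>q\<close> this is the weighted inequality between the arithmetic and geometric means
  of the numbers \<open>norm (z $ j) powr q\<close>. It follows from \<open>1 + s \<le> exp s\<close>: multiplying the bounds
  \<open>x\<^sub>j / \<alpha>\<^sub>j \<le> exp (x\<^sub>j / \<alpha>\<^sub>j - 1)\<close> with multiplicities \<open>\<alpha>\<^sub>j\<close> gives
  \<open>\<Prod> (x\<^sub>j / \<alpha>\<^sub>j) ^ \<alpha>\<^sub>j \<le> exp (\<Sum> (x\<^sub>j - \<alpha>\<^sub>j))\<close>, and for \<open>x\<^sub>j = k * norm (z $ j) powr q\<close> with
  \<open>k = \<Sum> \<alpha>\<^sub>j\<close> the exponent is negative on the ball.
\<close>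
lemma monomial_const_mult_norm_less_1:
  assumes p: "1 \<le> p" and z: "z \<in> lp_ball p" and \<alpha>: "mi_size \<alpha> \<ge> 1"
  shows "monomial_const p \<alpha> * norm (mi_monom z \<alpha>) < 1"
  using p
proof (cases rule: lp_exponent_cases)
  case infinite
  have z1: "norm (z $ j) < 1" for j using z infinite by (simp add: mem_lp_ball_infinite_iff)
  obtain i where i: "\<alpha> i > 0" using \<alpha> by (force simp: mi_size_def)
  have "(\<Prod>j\<in>UNIV. norm (z $ j) ^ \<alpha> j)
      = norm (z $ i) ^ \<alpha> i * (\<Prod>j\<in>UNIV - {i}. norm (z $ j) ^ \<alpha> j)"
    by (rule prod.remove) auto
  also have "\<dots> \<le> norm (z $ i) ^ \<alpha> i * 1"
    using z1 by (intro mult_left_mono prod_le_1) (auto simp: less_imp_le[OF z1] intro!: power_le_one)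
  also have "\<dots> < 1" using z1[of i] i by (simp add: power_less_one_iff)
  finally have "norm (mi_monom z \<alpha>) < 1" by (simp add: norm_mi_monom)
  moreover have "monomial_const p \<alpha> = 1"
    using \<alpha> mi_self_power_pos[of \<alpha>] by (simp add: monomial_const_def infinite)
  ultimately show ?thesis by simp
next
  case (finite q)
  define k where "k = mi_size \<alpha>"
  define x where "x j = real k * norm (z $ j) powr q" for j
  have k: "k > 0" using \<alpha> by (simp add: k_def)
  have le: "x j ^ \<alpha> j \<le> real (\<alpha> j ^ \<alpha> j) * exp (x j - real (\<alpha> j))" for j
  proof (cases "\<alpha> j = 0")
    case True
    then show ?thesis by (simp add: x_def)
  next
    case False
    have "x j / \<alpha> j \<le> exp (x j / \<alpha> j - 1)"
      using exp_ge_add_one_self[of "x j / \<alpha> j - 1"] by simp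
    then have "(x j / \<alpha> j) ^ \<alpha> j \<le> exp (x j / \<alpha> j - 1) ^ \<alpha> j"
      by (intro power_mono) (auto simp: x_def)
    also have "\<dots> = exp (x j - \<alpha> j)"
      using False by (simp add: exp_of_nat_mult[symmetric] right_diff_distrib)
    finally show ?thesis
      using False by (simp add: power_divide divide_le_eq mult.commute)
  qed
  have "(\<Sum>j\<in>UNIV. x j) < k"
    using z finite k by (simp add: mem_lp_ball_finite_iff x_def flip: sum_distrib_left)
  then have sum_lt: "(\<Sum>j\<in>UNIV. x j - real (\<alpha> j)) < 0"
    by (simp add: sum_subtractf k_def mi_size_def)
  have "(\<Prod>j\<in>UNIV. x j ^ \<alpha> j) \<le> (\<Prod>j\<in>UNIV. real (\<alpha> j ^ \<alpha> j) * exp (x j - real (\<alpha> j)))"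
    using le by (intro prod_mono) (auto simp: x_def)
  also have "\<dots> = real (mi_self_power \<alpha>) * exp (\<Sum>j\<in>UNIV. x j - real (\<alpha> j))"
    by (simp add: prod.distrib mi_self_power_def exp_sum)
  also have "\<dots> < real (mi_self_power \<alpha>) * 1"
    using mi_self_power_pos[of \<alpha>] sum_lt by (intro mult_strict_left_mono) auto
  finally have "(\<Prod>j\<in>UNIV. x j ^ \<alpha> j) < real (mi_self_power \<alpha>)" by simp
  moreover have "(\<Prod>j\<in>UNIV. x j ^ \<alpha> j) = real k ^ k * norm (mi_monom z \<alpha>) powr q"
  proof -
    have "(norm (z $ j) powr q) ^ \<alpha> j = (norm (z $ j) ^ \<alpha> j) powr q" for j
      using finite by (cases "\<alpha> j = 0"; cases "z $ j = 0")
        (auto simp: power_0_left powr_power powr_realpow[symmetric] powr_powr mult.commute)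
    then show ?thesis
      by (simp add: x_def power_mult_distrib prod.distrib norm_mi_monom k_def mi_size_def
          power_sum prod_powr_distrib)
  qed
  moreover define X where "X = real (k ^ k) / real (mi_self_power \<alpha>)"
  ultimately have "X * norm (mi_monom z \<alpha>) powr q < 1"
    using mi_self_power_pos[of \<alpha>] by (simp add: divide_less_eq)
  then have "(X * norm (mi_monom z \<alpha>) powr q) powr (1 / q) < 1 powr (1 / q)"
    using finite by (intro powr_less_mono2) (auto simp: X_def)
  then have "X powr (1 / q) * (norm (mi_monom z \<alpha>) powr q) powr (1 / q) < 1"
    by (simp add: powr_mult)
  moreover have "(norm (mi_monom z \<alpha>) powr q) powr (1 / q) = norm (mi_monom z \<alpha>)"
    using finite by (simp add: powr_powr)
  moreover have "real_of_ereal (1 / p) = 1 / q"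
    using finite by (simp add: one_ereal_def)
  ultimately show ?thesis
    by (simp add: monomial_const_def k_def X_def)
qed

text \<open>
  Equality in the means inequality forces \<open>norm (z $ j) powr q\<close> to be proportional to \<open>\<alpha> j\<close>; the
  factor \<open>t\<close> moves this boundary point into the ball. At \<open>p = \<infinity>\<close> the exponent \<open>e\<close> is \<open>0\<close> and the
  same formula puts \<open>t\<close> into every coordinate with \<open>\<alpha> j > 0\<close> and, since \<open>0 powr 0 = 0\<close>, leaves the
  others at \<open>0\<close>, which is harmless for the monomial.
\<close>
lemma lp_ball_extremal_point:
  fixes \<alpha> :: "'n::finite \<Rightarrow> nat"
  assumes p: "1 \<le> p" and \<alpha>: "mi_size \<alpha> \<ge> 1" and t: "0 \<le> t" "t < 1"
  obtains z :: "complex ^ 'n" where "z \<in> lp_ball p"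
    "of_real (monomial_const p \<alpha>) * mi_monom z \<alpha> = of_real (t ^ mi_size \<alpha>)"
proof
  define k where "k = mi_size \<alpha>"
  define e where "e = real_of_ereal (1 / p)"
  define r where "r j = t * (real (\<alpha> j) / real k) powr e" for j
  define z :: "complex ^ 'n" where "z = (\<chi> j. of_real (r j))"
  have k: "k > 0" using \<alpha> by (simp add: k_def)
  have r: "norm (z $ j) = r j" for j using t by (simp add: z_def r_def del: of_real_mult)
  show "z \<in> lp_ball p"
    using p
  proof (cases rule: lp_exponent_cases)
    case infinite
    then have "r j \<le> t" for j using t by (simp add: r_def e_def)
    then show ?thesis using t infinite by (auto simp: mem_lp_ball_infinite_iff r intro: le_less_trans)
  next
    case (finite q)
    have e: "e = 1 / q" using finite by (simp add: e_def one_ereal_def)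
    have "(\<Sum>j\<in>UNIV. r j powr q) = (\<Sum>j\<in>UNIV. t powr q * (real (\<alpha> j) / real k))"
      using t finite by (intro sum.cong refl) (simp add: r_def e powr_mult powr_powr)
    also have "\<dots> = t powr q * (real (\<Sum>j\<in>UNIV. \<alpha> j) / real k)"
      by (simp add: sum_distrib_left sum_divide_distrib)
    also have "(\<Sum>j\<in>UNIV. \<alpha> j) = k" by (simp add: k_def mi_size_def)
    also have "t powr q * (real k / real k) = t powr q" using k by simp
    also have "\<dots> < 1" using t finite powr_less_mono2[of q t 1] by simp
    finally show ?thesis using finite by (simp add: mem_lp_ball_finite_iff r)
  qed
  have "(\<Prod>j\<in>UNIV. r j ^ \<alpha> j) = t ^ k * (\<Prod>j\<in>UNIV. ((real (\<alpha> j) / real k) powr e) ^ \<alpha> j)"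
    by (simp add: r_def power_mult_distrib prod.distrib k_def mi_size_def power_sum)
  also have "(\<Prod>j\<in>UNIV. ((real (\<alpha> j) / real k) powr e) ^ \<alpha> j)
      = (\<Prod>j\<in>UNIV. ((real (\<alpha> j) / real k) ^ \<alpha> j) powr e)"
  proof (intro prod.cong refl)
    fix j
    show "((real (\<alpha> j) / real k) powr e) ^ \<alpha> j = ((real (\<alpha> j) / real k) ^ \<alpha> j) powr e"
      using k by (cases "\<alpha> j = 0") (simp_all add: powr_power powr_realpow[symmetric] powr_powr mult.commute)
  qed
  also have "\<dots> = (\<Prod>j\<in>UNIV. (real (\<alpha> j) / real k) ^ \<alpha> j) powr e"
    by (simp add: prod_powr_distrib)
  also have "(\<Prod>j\<in>UNIV. (real (\<alpha> j) / real k) ^ \<alpha> j) = real (mi_self_power \<alpha>) / real (k ^ k)"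
    by (simp add: power_divide prod_dividef mi_self_power_def k_def mi_size_def power_sum)
  finally have "(\<Prod>j\<in>UNIV. r j ^ \<alpha> j) = t ^ k * (real (mi_self_power \<alpha>) / real (k ^ k)) powr e" .
  moreover have "(real (k ^ k) / real (mi_self_power \<alpha>)) powr e
      * (real (mi_self_power \<alpha>) / real (k ^ k)) powr e = 1"
    using k mi_self_power_pos[of \<alpha>] by (simp add: powr_mult[symmetric])
  ultimately have "monomial_const p \<alpha> * (\<Prod>j\<in>UNIV. r j ^ \<alpha> j) = t ^ k"
    by (simp add: monomial_const_def k_def e_def)
  then have "complex_of_real (monomial_const p \<alpha> * (\<Prod>j\<in>UNIV. r j ^ \<alpha> j)) = of_real (t ^ k)" by simp
  then show "of_real (monomial_const p \<alpha>) * mi_monom z \<alpha> = of_real (t ^ mi_size \<alpha>)"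
    by (simp add: mi_monom_def z_def k_def)
qed

section \<open>Bounds for homogeneous parts and coefficients\<close>

lemma mi_monom_scale: "mi_monom (\<zeta> *s z) \<alpha> = \<zeta> ^ mi_size \<alpha> * mi_monom z \<alpha>"
  by (simp add: mi_monom_def mi_size_def power_mult_distrib prod.distrib power_sum)

text \<open>
  Cauchy's estimate on the torus through \<open>z\<close>, with the integral replaced by the mean over vectors
  of \<open>N\<close>-th roots of unity. Since \<open>N\<close> exceeds all exponents in \<open>A\<close>, the monomials are orthogonal on
  this finite group: the mean factors over the coordinates.
\<close>
lemma torus_coefficient_bound:
  fixes c :: "('n::finite \<Rightarrow> nat) \<Rightarrow> complex" and z :: "complex ^ 'n"
  assumes A: "finite A" "\<alpha> \<in> A"
    and bound: "\<And>w. (\<And>j. norm (w $ j) = norm (z $ j)) \<Longrightarrow> norm (\<Sum>\<beta>\<in>A. c \<beta> * mi_monom w \<beta>) \<le> K"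
  shows "norm (c \<alpha> * mi_monom z \<alpha>) \<le> K"
proof -
  define N where "N = Suc (\<Sum>\<beta>\<in>A. mi_size \<beta>)"
  define u where "u = cis (2 * pi / real N)"
  \<comment> \<open>\<open>w g\<close> ranges over the rotated points, and \<open>\<phi> g\<close> is the conjugate of the character of \<open>\<alpha>\<close>;
    the exponent \<open>N - \<alpha> j\<close> represents \<open>- \<alpha> j\<close> modulo \<open>N\<close>.\<close>
  define T where "T = PiE (UNIV :: 'n set) (\<lambda>_. {..<N})"
  define w where "w g = (\<chi> j. u ^ g j * z $ j)" for g :: "'n \<Rightarrow> nat"
  define \<phi> where "\<phi> g = (\<Prod>j\<in>UNIV. (u ^ g j) ^ (N - \<alpha> j))" for g :: "'n \<Rightarrow> nat"
  have N: "N > 0" by (simp add: N_def)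
  have nu: "norm (u ^ m) = 1" for m by (simp add: u_def norm_power)
  have lt: "\<beta> j < N" if "\<beta> \<in> A" for \<beta> j
  proof -
    have "\<beta> j \<le> mi_size \<beta>" by (auto simp: mi_size_def intro!: member_le_sum)
    also have "\<dots> \<le> (\<Sum>\<beta>\<in>A. mi_size \<beta>)" using A that by (intro member_le_sum) auto
    finally show ?thesis by (simp add: N_def)
  qed
  have card: "card T = N ^ CARD('n)" by (simp add: T_def card_PiE)
  have dvd: "N dvd \<beta> j + (N - \<alpha> j) \<longleftrightarrow> \<beta> j = \<alpha> j" if "\<beta> \<in> A" for \<beta> j
  proof
    assume "N dvd \<beta> j + (N - \<alpha> j)"
    then obtain d where d: "\<beta> j + (N - \<alpha> j) = N * d" by (elim dvdE)
    have "\<beta> j + (N - \<alpha> j) < N * 2" "N * 0 < \<beta> j + (N - \<alpha> j)"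
      using lt[OF that, of j] lt[OF A(2), of j] by auto
    then have "N * d < N * 2" "N * 0 < N * d"
      unfolding d by this+
    then have "d = 1" by (simp only: mult_less_cancel1) simp
    then show "\<beta> j = \<alpha> j" using d lt[OF A(2), of j] by simp
  qed (use lt[OF A(2), of j] in auto)
  have mono_w: "mi_monom (w g) \<beta> * \<phi> g = mi_monom z \<beta> * (\<Prod>j\<in>UNIV. (u ^ g j) ^ (\<beta> j + (N - \<alpha> j)))" for g \<beta>
    by (simp add: mi_monom_def w_def \<phi>_def power_mult_distrib prod.distrib power_add mult_ac)
  have orth: "(\<Sum>g\<in>T. mi_monom (w g) \<beta> * \<phi> g) = (if \<beta> = \<alpha> then of_nat (card T) * mi_monom z \<alpha> else 0)"
    if "\<beta> \<in> A" for \<beta>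
  proof -
    have "(\<Sum>g\<in>T. mi_monom (w g) \<beta> * \<phi> g)
        = mi_monom z \<beta> * (\<Sum>g\<in>T. \<Prod>j\<in>UNIV. (u ^ g j) ^ (\<beta> j + (N - \<alpha> j)))"
      by (simp add: mono_w sum_distrib_left)
    also have "(\<Sum>g\<in>T. \<Prod>j\<in>UNIV. (u ^ g j) ^ (\<beta> j + (N - \<alpha> j)))
        = (\<Prod>j\<in>UNIV. \<Sum>y<N. (u ^ y) ^ (\<beta> j + (N - \<alpha> j)))"
      unfolding T_def by (rule prod_sum_PiE[symmetric]) auto
    also have "\<dots> = (\<Prod>j\<in>UNIV. if \<beta> j = \<alpha> j then of_nat N else 0)"
      by (simp add: u_def sum_powers_root_of_unity[OF N] dvd[OF that])
    also have "\<dots> = (if \<beta> = \<alpha> then of_nat (card T) else 0)"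
      by (auto simp: card fun_eq_iff intro!: prod_zero)
    finally show ?thesis by auto
  qed
  have "(\<Sum>g\<in>T. (\<Sum>\<beta>\<in>A. c \<beta> * mi_monom (w g) \<beta>) * \<phi> g)
      = (\<Sum>\<beta>\<in>A. c \<beta> * (\<Sum>g\<in>T. mi_monom (w g) \<beta> * \<phi> g))"
    unfolding sum_distrib_right sum_distrib_left by (subst sum.swap) (simp add: mult.assoc)
  also have "\<dots> = (\<Sum>\<beta>\<in>A. if \<beta> = \<alpha> then c \<alpha> * (of_nat (card T) * mi_monom z \<alpha>) else 0)"
    by (intro sum.cong refl) (simp add: orth)
  also have "\<dots> = of_nat (card T) * (c \<alpha> * mi_monom z \<alpha>)"
    using A by simp
  finally have "real (card T) * norm (c \<alpha> * mi_monom z \<alpha>)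
      = norm (\<Sum>g\<in>T. (\<Sum>\<beta>\<in>A. c \<beta> * mi_monom (w g) \<beta>) * \<phi> g)"
    by (simp add: norm_mult)
  also have "\<dots> \<le> (\<Sum>g\<in>T. K)"
  proof (rule sum_norm_le)
    fix g
    have "norm (\<phi> g) = 1"
      by (simp add: \<phi>_def norm_power nu[unfolded norm_power] flip: prod_norm)
    moreover have "norm (\<Sum>\<beta>\<in>A. c \<beta> * mi_monom (w g) \<beta>) \<le> K"
      by (rule bound) (simp add: w_def norm_mult nu)
    ultimately show "norm ((\<Sum>\<beta>\<in>A. c \<beta> * mi_monom (w g) \<beta>) * \<phi> g) \<le> K"
      by (simp add: norm_mult)
  qed
  finally show ?thesis using N by (simp add: card)
qed

lemma has_sum_by_size:
  fixes c :: "('n::finite \<Rightarrow> nat) \<Rightarrow> complex"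
  assumes "(c has_sum S) UNIV"
  shows "((\<lambda>m. \<Sum>\<alpha> | mi_size \<alpha> = m. c \<alpha>) has_sum S) UNIV"
proof (rule has_sum_SigmaD)
  show "((\<lambda>(m, \<alpha>). c \<alpha>) has_sum S) (SIGMA m:UNIV. {\<alpha>. mi_size \<alpha> = m})"
    using assms
    by (subst has_sum_reindex_bij_witness[of _ "\<lambda>\<alpha>. (mi_size \<alpha>, \<alpha>)" snd UNIV c _ S]) auto
qed (auto intro!: has_sum_finiteI finite_multi_indices_of_size)

definition hom_part ::
    "(('n::finite \<Rightarrow> nat) \<Rightarrow> complex) \<Rightarrow> (('n \<Rightarrow> nat) \<Rightarrow> complex) \<Rightarrow> complex ^ 'n \<Rightarrow> nat \<Rightarrow> complex" where
  "hom_part a b z m = (\<Sum>\<alpha> | mi_size \<alpha> = m. (a \<alpha> + b \<alpha>) * mi_monom z \<alpha>)"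

lemma hom_part_scale: "hom_part a b (\<zeta> *s z) = (\<lambda>m. hom_part a b z m * \<zeta> ^ m)"
  by (simp add: fun_eq_iff hom_part_def mi_monom_scale sum_distrib_left mult_ac)

text \<open>
  Conjugating the antiholomorphic part does not change the real part of \<open>f = h + cnj g\<close>, so
  \<open>Re f\<close> is the real part of the holomorphic \<open>h + g\<close>, whose coefficients are \<open>a \<alpha> + b \<alpha>\<close>. This is
  why the sums \<open>a \<alpha> + b \<alpha>\<close> are what a bound on \<open>Re f\<close> controls.
\<close>
lemma hom_part_has_sum:
  assumes "has_pluriharmonic_expansion_on \<Omega> f a b" "z \<in> \<Omega>"
  obtains s where "(hom_part a b z has_sum s) UNIV" "Re s = Re (f z)"
proof -
  obtain h g where f: "f z = h z + cnj (g z)"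
    and h: "((\<lambda>\<alpha>. a \<alpha> * mi_monom z \<alpha>) has_sum h z) UNIV"
    and g: "((\<lambda>\<alpha>. b \<alpha> * mi_monom z \<alpha>) has_sum g z) UNIV"
    using assms unfolding has_pluriharmonic_expansion_on_def by blast
  have "((\<lambda>\<alpha>. (a \<alpha> + b \<alpha>) * mi_monom z \<alpha>) has_sum (h z + g z)) UNIV"
    using has_sum_add[OF h g] by (simp add: ring_distribs)
  then have "(hom_part a b z has_sum (h z + g z)) UNIV"
    unfolding hom_part_def by (rule has_sum_by_size)
  then show thesis by (rule that) (simp add: f)
qed

text \<open>
  On the slice \<open>\<zeta> \<mapsto> \<zeta> *s z\<close> the function \<open>h + g\<close> becomes the power series with coefficients
  \<open>hom_part a b z m\<close>, and its real part is at most \<open>1\<close> on the closed unit disc; Caratheodory's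
  inequality applies.
\<close>
lemma norm_hom_part_le:
  assumes p: "1 \<le> p" and adm: "admissible p f a b" and z: "z \<in> lp_ball p" and k: "1 \<le> k"
  shows "norm (hom_part a b z k) \<le> 2 * (1 - Re (f 0))"
proof -
  have exp: "has_pluriharmonic_expansion_on (lp_ball p) f a b"
    using adm by (simp add: admissible_def)
  have scaled: "\<exists>s. (hom_part a b (\<zeta> *s z) sums s) \<and> Re s = Re (f (\<zeta> *s z)) \<and> Re s \<le> 1"
    if "norm \<zeta> \<le> 1" for \<zeta>
  proof -
    have mem: "\<zeta> *s z \<in> lp_ball p"
      using that by (intro lp_ball_dominated[OF p z]) (simp add: norm_mult mult_left_le_one_le)
    have "ereal (Re (f (\<zeta> *s z))) \<le> (SUP z\<in>lp_ball p. ereal (Re (f z)))"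
      by (rule SUP_upper[OF mem])
    also have "\<dots> \<le> 1" using adm by (simp add: admissible_def)
    finally have "Re (f (\<zeta> *s z)) \<le> 1" by simp
    then show ?thesis
      using hom_part_has_sum[OF exp mem] has_sum_imp_sums by metis
  qed
  have "norm (hom_part a b z k) \<le> 2 * (1 - Re (hom_part a b z 0))"
  proof (rule caratheodory_coefficient_bound[OF k])
    have "hom_part a b z summable_on UNIV"
      using hom_part_has_sum[OF exp z] by (metis summable_on_def)
    then show "summable (\<lambda>m. norm (hom_part a b z m))"
      by (simp add: summable_on_iff_abs_summable_on_complex summable_on_UNIV_nonneg_real_iff)
  next
    fix \<zeta> :: complex assume "norm \<zeta> = 1"
    then show "Re (\<Sum>m. hom_part a b z m * \<zeta> ^ m) \<le> 1"
      using scaled[of \<zeta>] unfolding hom_part_scale by (auto simp: sums_iff)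
  qed
  moreover have "Re (hom_part a b z 0) = Re (f 0)"
    using scaled[of 0] unfolding hom_part_scale by auto
  ultimately show ?thesis by simp
qed

lemma homogeneous_bound_2:
  assumes "1 \<le> p" "admissible p f a b" "1 \<le> k"
  shows "homogeneous_bound 2 p k f a b"
  unfolding homogeneous_bound_def
  using norm_hom_part_le[OF assms(1,2) _ assms(3)]
  by (intro SUP_least) (simp add: hom_part_def)

text \<open>
  Cauchy's estimate for the \<open>k\<close>-homogeneous part, taken on tori that approach the one on which the
  monomial is largest.
\<close>
lemma coefficient_bound_2:
  assumes p: "1 \<le> p" and adm: "admissible p f a b" and \<alpha>: "mi_size \<alpha> \<ge> 1"
  shows "coefficient_bound 2 p \<alpha> f a b"
proof -
  let ?k = "mi_size \<alpha>" and ?K = "monomial_const p \<alpha> * (2 * (1 - Re (f 0)))"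
  have "x * norm (a \<alpha> + b \<alpha>) \<le> ?K" if x: "0 < x" "x < 1" for x
  proof -
    define t where "t = root ?k x"
    have t: "0 \<le> t" "t < 1" and tk: "t ^ ?k = x"
      using x \<alpha> by (simp_all add: t_def)
    obtain z where z: "z \<in> lp_ball p"
      and ext: "of_real (monomial_const p \<alpha>) * mi_monom z \<alpha> = of_real (t ^ mi_size \<alpha>)"
      using lp_ball_extremal_point[OF p \<alpha> t] by blast
    have "norm ((a \<alpha> + b \<alpha>) * mi_monom z \<alpha>) \<le> 2 * (1 - Re (f 0))"
    proof (rule torus_coefficient_bound)
      fix w :: "complex ^ 'a" assume "\<And>j. norm (w $ j) = norm (z $ j)"
      then have "w \<in> lp_ball p" by (intro lp_ball_dominated[OF p z]) simp
      from norm_hom_part_le[OF p adm this \<alpha>]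
      show "norm (\<Sum>\<beta> | mi_size \<beta> = ?k. (a \<beta> + b \<beta>) * mi_monom w \<beta>) \<le> 2 * (1 - Re (f 0))"
        by (simp add: hom_part_def)
    qed (simp_all add: finite_multi_indices_of_size)
    then have "monomial_const p \<alpha> * norm ((a \<alpha> + b \<alpha>) * mi_monom z \<alpha>) \<le> ?K"
      using monomial_const_pos[OF \<alpha>, of p] by (intro mult_left_mono) auto
    moreover have "monomial_const p \<alpha> * norm (mi_monom z \<alpha>) = x"
    proof -
      have "norm (of_real (monomial_const p \<alpha>) * mi_monom z \<alpha>) = x"
        unfolding ext tk using x by simp
      then show ?thesis using monomial_const_pos[OF \<alpha>, of p] by (simp add: norm_mult)
    qed
    moreover have "monomial_const p \<alpha> * norm ((a \<alpha> + b \<alpha>) * mi_monom z \<alpha>)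
        = (monomial_const p \<alpha> * norm (mi_monom z \<alpha>)) * norm (a \<alpha> + b \<alpha>)"
      by (simp add: norm_mult mult_ac)
    ultimately show ?thesis by simp
  qed
  then have "norm (a \<alpha> + b \<alpha>) \<le> ?K" by (rule field_le_mult_one_interval)
  then show ?thesis unfolding coefficient_bound_def monomial_const_def[symmetric] by (simp only: mult_ac)
qed

section \<open>Pluriharmonicity of rational functions\<close>

text \<open>
  A class of functions that contains the extremal functions and is closed under directional
  derivatives. Closure makes smoothness of any order follow from one induction, so that neither the
  second derivatives nor the Laplacian of a concrete function ever have to be computed.
\<close>
inductive rational_on :: "(complex ^ 'n) set \<Rightarrow> (complex ^ 'n \<Rightarrow> complex) \<Rightarrow> bool" for U where
  rational_const: "rational_on U (\<lambda>_. c)"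
| rational_coord: "rational_on U (\<lambda>z. z $ j)"
| rational_add: "rational_on U f \<Longrightarrow> rational_on U g \<Longrightarrow> rational_on U (\<lambda>z. f z + g z)"
| rational_mult: "rational_on U f \<Longrightarrow> rational_on U g \<Longrightarrow> rational_on U (\<lambda>z. f z * g z)"
| rational_inverse: "rational_on U f \<Longrightarrow> (\<And>z. z \<in> U \<Longrightarrow> f z \<noteq> 0) \<Longrightarrow> rational_on U (\<lambda>z. inverse (f z))"

text \<open>
  The derivative is a bare function rather than a bounded linear operator, so that
  \<open>\<lambda>z. D z v\<close> is again a complex function of the same kind.
\<close>
definition has_complex_derivs_on ::
    "(complex ^ 'n) set \<Rightarrow> (complex ^ 'n \<Rightarrow> complex)
      \<Rightarrow> (complex ^ 'n \<Rightarrow> complex ^ 'n \<Rightarrow> complex) \<Rightarrow> bool" where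
  "has_complex_derivs_on U f D \<longleftrightarrow>
     (\<forall>z\<in>U. (f has_derivative D z) (at z) \<and> (\<forall>c v. D z (c *s v) = c * D z v))"

lemma rational_on_derivative:
  "rational_on U f \<Longrightarrow> \<exists>D. has_complex_derivs_on U f D \<and> (\<forall>v. rational_on U (\<lambda>z. D z v))"
proof (induction rule: rational_on.induct)
  case (rational_const c)
  show ?case
    by (rule exI[of _ "\<lambda>_ _. 0"]) (auto simp: has_complex_derivs_on_def intro: rational_on.intros)
next
  case (rational_coord j)
  have "((\<lambda>z. z $ j) has_derivative (\<lambda>v. v $ j)) (at z)" for z :: "complex ^ 'a"
    by (rule bounded_linear.has_derivative[OF bounded_linear_vec_nth]) (rule has_derivative_ident)
  then show ?case
    by (intro exI[of _ "\<lambda>_ v. v $ j"]) (auto simp: has_complex_derivs_on_def intro: rational_on.intros)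
next
  case (rational_add f g)
  then obtain D E where D: "has_complex_derivs_on U f D" "\<And>v. rational_on U (\<lambda>z. D z v)"
    and E: "has_complex_derivs_on U g E" "\<And>v. rational_on U (\<lambda>z. E z v)" by blast
  show ?case
    by (intro exI[of _ "\<lambda>z v. D z v + E z v"])
      (use D E in \<open>auto simp: has_complex_derivs_on_def ring_distribs
        intro: rational_on.intros has_derivative_add\<close>)
next
  case (rational_mult f g)
  then obtain D E where D: "has_complex_derivs_on U f D" "\<And>v. rational_on U (\<lambda>z. D z v)"
    and E: "has_complex_derivs_on U g E" "\<And>v. rational_on U (\<lambda>z. E z v)" by blast
  have "has_complex_derivs_on U (\<lambda>z. f z * g z) (\<lambda>z v. f z * E z v + D z v * g z)"
    using D(1) E(1) unfolding has_complex_derivs_on_def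
    by (auto intro!: has_derivative_mult) (auto simp: algebra_simps)
  moreover have "rational_on U (\<lambda>z. f z * E z v + D z v * g z)" for v
    using D(2) E(2) rational_mult.hyps by (intro rational_on.intros(3,4))
  ultimately show ?case by blast
next
  case (rational_inverse f)
  then obtain D where D: "has_complex_derivs_on U f D" "\<And>v. rational_on U (\<lambda>z. D z v)" by blast
  have "rational_on U (\<lambda>z. inverse (f z))"
    using rational_inverse.hyps by (rule rational_on.rational_inverse)
  then have "rational_on U (\<lambda>z. (- 1) * (inverse (f z) * D z v * inverse (f z)))" for v
    using D(2) by (intro rational_on.intros(1,4))
  then show ?case
    by (intro exI[of _ "\<lambda>z v. - (inverse (f z) * D z v * inverse (f z))"])
      (use D rational_inverse.hyps in \<open>auto simp: has_complex_derivs_on_def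
        intro!: has_derivative_inverse\<close>)
qed

lemma rational_on_continuous: "rational_on U f \<Longrightarrow> continuous_on U f"
  using rational_on_derivative[of U f]
  by (auto simp: has_complex_derivs_on_def
      intro!: continuous_at_imp_continuous_on dest: has_derivative_continuous)

lemma rational_on_prod:
  "finite A \<Longrightarrow> (\<And>j. j \<in> A \<Longrightarrow> rational_on U (f j)) \<Longrightarrow> rational_on U (\<lambda>z. \<Prod>j\<in>A. f j z)"
  by (induction rule: finite_induct) (auto intro: rational_on.intros)

lemma rational_on_power: "rational_on U f \<Longrightarrow> rational_on U (\<lambda>z. f z ^ m)"
  by (induction m) (auto intro: rational_on.intros)

lemma rational_on_monom: "rational_on U (\<lambda>z. mi_monom z \<alpha>)"
  unfolding mi_monom_def by (intro rational_on_prod rational_on_power rational_coord) auto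

text \<open>
  The operator-valued derivatives are assembled from directional ones along a basis:
  \<open>E i c\<close> is the operator \<open>v \<mapsto> (v \<bullet> i) *\<^sub>R c\<close>, so the derivative of \<open>f\<close> is the finite sum of the
  \<open>E i (D z i)\<close> and can be differentiated term by term.
\<close>
lemma rational_on_imp_C2_on:
  assumes "rational_on U f"
  shows "C2_on U f"
proof -
  obtain D where D: "has_complex_derivs_on U f D" and rD: "\<And>v. rational_on U (\<lambda>z. D z v)"
    using rational_on_derivative[OF assms] by blast
  obtain D2 where D2: "\<And>v. has_complex_derivs_on U (\<lambda>z. D z v) (D2 v)"
    and rD2: "\<And>v w. rational_on U (\<lambda>z. D2 v z w)"
    using rational_on_derivative[OF rD] by metis
  define E :: "complex ^ 'a \<Rightarrow> complex \<Rightarrow> (complex ^ 'a) \<Rightarrow>\<^sub>L complex"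
    where "E i c = blinfun_scaleR_left c o\<^sub>L blinfun_inner_left i" for i c
  have E: "bounded_linear (E i)" for i
    unfolding E_def by (intro bounded_linear_compose[OF
        bounded_bilinear.bounded_linear_left[OF bounded_bilinear_blinfun_compose]]
        bounded_linear_blinfun_scaleR_left)
  define f' where "f' z = (\<Sum>i\<in>Basis. E i (D z i))" for z
  define f'' where "f'' z = (\<Sum>i\<in>Basis. Blinfun (E i) o\<^sub>L Blinfun (D2 i z))" for z
  have f': "blinfun_apply (f' z) = D z" if "z \<in> U" for z
  proof
    fix v
    have lin: "linear (D z)"
      using D that by (auto simp: has_complex_derivs_on_def intro: has_derivative_linear)
    have "D z v = D z (\<Sum>i\<in>Basis. (v \<bullet> i) *\<^sub>R i)" by (simp add: euclidean_representation)
    also have "\<dots> = (\<Sum>i\<in>Basis. (v \<bullet> i) *\<^sub>R D z i)"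
      by (simp add: linear_sum[OF lin] linear_scale[OF lin])
    finally show "blinfun_apply (f' z) v = D z v"
      by (simp add: f'_def E_def blinfun.sum_left)
  qed
  have f'': "blinfun_apply (f'' z) v = (\<Sum>i\<in>Basis. E i (D2 i z v))" if "z \<in> U" for z v
  proof -
    have "bounded_linear (D2 i z)" for i
      using D2[of i] that by (auto simp: has_complex_derivs_on_def intro: has_derivative_bounded_linear)
    then show ?thesis
      by (simp add: f''_def blinfun.sum_left bounded_linear_Blinfun_apply E)
  qed
  have "has_C2_derivs_on U f f' f''"
    unfolding has_C2_derivs_on_def
  proof (intro conjI ballI)
    fix z assume z: "z \<in> U"
    show "(f has_derivative blinfun_apply (f' z)) (at z)"
      using D z by (simp add: has_complex_derivs_on_def f')
    have "(f' has_derivative (\<lambda>v. \<Sum>i\<in>Basis. E i (D2 i z v))) (at z)"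
      unfolding f'_def using D2 z
      by (intro has_derivative_sum bounded_linear.has_derivative[OF E])
        (auto simp: has_complex_derivs_on_def)
    moreover have "blinfun_apply (f'' z) = (\<lambda>v. \<Sum>i\<in>Basis. E i (D2 i z v))"
      using f''[OF z] by blast
    ultimately show "(f' has_derivative blinfun_apply (f'' z)) (at z)" by simp
  next
    have cont: "continuous_on U (\<lambda>z. \<Sum>i\<in>Basis. E i (D2 i z v))" for v
      by (intro continuous_on_sum bounded_linear.continuous_on[OF E] rational_on_continuous rD2)
    show "continuous_on U f''"
      by (rule continuous_on_blinfun_componentwise) (simp add: f'' cont cong: continuous_on_cong)
  qed
  then show ?thesis by (auto simp: C2_on_def)
qed

text \<open>
  The second derivative acts by \<open>(h, k) \<mapsto> u2 x * h * k\<close>, so the Laplacian is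
  \<open>u2 x * (1 + \<i> * \<i>) = 0\<close>.
\<close>
lemma harmonic_on_of_complex_derivs:
  fixes u :: "complex \<Rightarrow> complex"
  assumes u: "\<And>x. x \<in> S \<Longrightarrow> (u has_field_derivative u1 x) (at x)"
    and u1: "\<And>x. x \<in> S \<Longrightarrow> (u1 has_field_derivative u2 x) (at x)"
    and u2: "continuous_on S u2"
  shows "harmonic_on S u"
proof -
  define B :: "complex \<Rightarrow>\<^sub>L complex \<Rightarrow>\<^sub>L complex" where "B = Blinfun blinfun_mult_right"
  have B: "blinfun_apply B = blinfun_mult_right"
    by (simp add: B_def bounded_linear_Blinfun_apply bounded_linear_blinfun_mult_right)
  define U2 where "U2 x = B o\<^sub>L blinfun_mult_right (u2 x)" for x
  have "has_C2_derivs_on S u (\<lambda>x. blinfun_mult_right (u1 x)) U2"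
    unfolding has_C2_derivs_on_def
  proof (intro conjI ballI)
    fix x assume x: "x \<in> S"
    show "(u has_derivative blinfun_apply (blinfun_mult_right (u1 x))) (at x)"
      using u[OF x] by (simp add: has_field_derivative_def)
    have "(u1 has_derivative (\<lambda>h. u2 x * h)) (at x)"
      using u1[OF x] by (simp add: has_field_derivative_def)
    from bounded_linear.has_derivative[OF bounded_linear_blinfun_mult_right this]
    show "((\<lambda>x. blinfun_mult_right (u1 x)) has_derivative blinfun_apply (U2 x)) (at x)"
      by (simp add: U2_def B o_def blinfun_compose.rep_eq)
  next
    show "continuous_on S U2"
      unfolding U2_def
      by (intro continuous_intros bounded_linear.continuous_on[OF bounded_linear_blinfun_mult_right u2])
  qed
  moreover have "(\<Sum>e\<in>Basis. blinfun_apply (blinfun_apply (U2 x) e) e) = 0" for x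
    by (simp add: U2_def B Basis_complex_def mult.assoc)
  ultimately show ?thesis unfolding harmonic_on_def by blast
qed

lemma norm_vector_scalar_mult: "norm (c *s z) = norm c * norm (z :: complex ^ 'n)"
  by (simp add: norm_vec_def norm_mult L2_set_right_distrib)

lemma line_has_derivative: "((\<lambda>\<zeta>. z + \<zeta> *s \<theta>) has_derivative (\<lambda>\<zeta>. \<zeta> *s \<theta>)) (at x)"
  for \<theta> :: "complex ^ 'n"
proof -
  have "bounded_linear (\<lambda>\<zeta>. \<zeta> *s \<theta>)"
    by (intro linear_conv_bounded_linear[THEN iffD1] linearI)
      (simp_all add: vec_eq_iff ring_distribs)
  then show ?thesis
    by (auto intro!: derivative_eq_intros bounded_linear_imp_has_derivative)
qed

text \<open>
  A segment leaving the set would meet its frontier closer to \<open>z\<close> than the distance allows.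
\<close>
lemma add_mem_of_norm_less_boundary_dist:
  fixes z v :: "'a :: euclidean_space"
  assumes z: "z \<in> \<Omega>" and v: "ereal (norm v) < boundary_dist \<Omega> z"
  shows "z + v \<in> \<Omega>"
proof (rule ccontr)
  assume "z + v \<notin> \<Omega>"
  then have "closed_segment z (z + v) \<inter> frontier \<Omega> \<noteq> {}"
    using z by (intro connected_Int_frontier connected_segment) auto
  then obtain w where w: "w \<in> closed_segment z (z + v)" "w \<in> frontier \<Omega>" by blast
  have "dist z w \<le> norm v"
    using w(1) dist_in_closed_segment[of w z "z + v"] by (simp add: dist_norm norm_minus_commute)
  moreover have "boundary_dist \<Omega> z \<le> ereal (dist z w)"
    unfolding boundary_dist_def using w(2) by (rule INF_lower)
  ultimately show False using v by (metis ereal_less_eq(3) leD order_trans)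
qed

text \<open>
  By complex linearity the derivative of \<open>\<zeta> \<mapsto> f (z + \<zeta> *s \<theta>)\<close> is multiplication by the directional
  derivative of \<open>f\<close> along \<open>\<theta>\<close>, which is again rational; so restrictions to complex lines have two
  complex derivatives.
\<close>
lemma rational_on_imp_pluriharmonic_on:
  assumes "rational_on \<Omega> f"
  shows "pluriharmonic_on \<Omega> f"
  unfolding pluriharmonic_on_def
proof (intro conjI ballI allI impI)
  show "C2_on \<Omega> f" using assms by (rule rational_on_imp_C2_on)
next
  fix z \<theta> :: "complex ^ 'a" assume z: "z \<in> \<Omega>" and \<theta>: "norm \<theta> = 1"
  let ?S = "{\<zeta>. ereal (norm \<zeta>) < boundary_dist \<Omega> z}"
  have mem: "z + \<zeta> *s \<theta> \<in> \<Omega>" if "\<zeta> \<in> ?S" for \<zeta>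
    using that by (intro add_mem_of_norm_less_boundary_dist[OF z]) (simp add: norm_vector_scalar_mult \<theta>)
  obtain D where D: "has_complex_derivs_on \<Omega> f D" and rD: "\<And>v. rational_on \<Omega> (\<lambda>z. D z v)"
    using rational_on_derivative[OF assms] by blast
  obtain D2 where D2: "has_complex_derivs_on \<Omega> (\<lambda>z. D z \<theta>) D2"
    and rD2: "\<And>v. rational_on \<Omega> (\<lambda>z. D2 z v)"
    using rational_on_derivative[OF rD] by blast
  have chain: "((\<lambda>\<zeta>. g (z + \<zeta> *s \<theta>)) has_field_derivative G (z + \<zeta> *s \<theta>) \<theta>) (at \<zeta>)"
    if "has_complex_derivs_on \<Omega> g G" "\<zeta> \<in> ?S" for g G \<zeta>
  proof -
    have G: "(g has_derivative G (z + \<zeta> *s \<theta>)) (at (z + \<zeta> *s \<theta>))"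
      and lin: "\<And>c. G (z + \<zeta> *s \<theta>) (c *s \<theta>) = c * G (z + \<zeta> *s \<theta>) \<theta>"
      using that mem by (auto simp: has_complex_derivs_on_def)
    from has_derivative_compose[OF line_has_derivative G]
    show ?thesis by (simp add: has_field_derivative_def lin mult_commute_abs)
  qed
  show "harmonic_on ?S (\<lambda>\<zeta>. f (z + \<zeta> *s \<theta>))"
  proof (rule harmonic_on_of_complex_derivs)
    show "continuous_on ?S (\<lambda>\<zeta>. D2 (z + \<zeta> *s \<theta>) \<theta>)"
    proof (rule continuous_on_compose2[OF rational_on_continuous[OF rD2]])
      show "continuous_on ?S (\<lambda>\<zeta>. z + \<zeta> *s \<theta>)"
        by (intro continuous_at_imp_continuous_on ballI has_derivative_continuous[OF line_has_derivative])
    qed (use mem in auto)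
  qed (use chain[OF D] chain[OF D2] in auto)
qed

lemma rational_on_imp_holomorphic_Cn_on: "rational_on \<Omega> f \<Longrightarrow> holomorphic_Cn_on \<Omega> f"
  using rational_on_derivative[of \<Omega> f]
  by (auto simp: holomorphic_Cn_on_def has_complex_derivs_on_def)

section \<open>Extremal functions\<close>

text \<open>
  The function is \<open>1 - (1 + w) / (1 - w)\<close>, where \<open>(1 + w) / (1 - w)\<close> maps the disc onto the right
  half-plane.
\<close>
lemma Re_neg_cayley_less_1:
  assumes "norm (w :: complex) < 1"
  shows "Re (- 2 * w / (1 - w)) < 1"
proof -
  have w: "1 - w \<noteq> 0" using assms by auto
  have "1 + 2 * w / (1 - w) = (1 + w) / (1 - w)"
    using w by (simp add: field_simps)
  also have "\<dots> = (1 + w) * cnj (1 - w) / of_real ((norm (1 - w))\<^sup>2)"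
    by (simp add: complex_div_cnj[of "1 + w"])
  finally have eq: "1 + 2 * w / (1 - w) = (1 + w) * cnj (1 - w) / of_real ((norm (1 - w))\<^sup>2)" .
  have "Re ((1 + w) * cnj (1 - w)) = 1 - (norm w)\<^sup>2"
    by (simp only: cmod_power2) (simp add: power2_eq_square algebra_simps)
  then have "Re (1 + 2 * w / (1 - w)) = (1 - (norm w)\<^sup>2) / (norm (1 - w))\<^sup>2"
    by (simp only: eq Re_divide_of_real)
  also have "\<dots> > 0"
    using assms w by (intro divide_pos_pos) (auto simp: power_less_one_iff abs_square_less_1)
  finally show ?thesis by simp
qed

text \<open>
  The half-plane map makes Caratheodory's inequality an equality in one variable; it is composed with
  the monomial scaled so as to map the ball into the unit disc.
\<close>
definition extremal_fun :: "ereal \<Rightarrow> ('n::finite \<Rightarrow> nat) \<Rightarrow> complex ^ 'n \<Rightarrow> complex" where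
  "extremal_fun p \<alpha> z =
     (let w = of_real (monomial_const p \<alpha>) * mi_monom z \<alpha> in - 2 * w / (1 - w))"

text \<open>
  The geometric series \<open>- 2 * w / (1 - w) = \<Sum>i\<ge>1. - 2 * w ^ i\<close> has terms exactly at the positive
  multiples of \<open>\<alpha>\<close>. Each set of summation has at most one element when \<open>\<alpha> \<noteq> 0\<close>.
\<close>
definition extremal_coeff :: "ereal \<Rightarrow> ('n::finite \<Rightarrow> nat) \<Rightarrow> ('n \<Rightarrow> nat) \<Rightarrow> complex" where
  "extremal_coeff p \<alpha> \<beta> =
     (\<Sum>i | i \<ge> 1 \<and> \<beta> = (\<lambda>j. i * \<alpha> j). - 2 * of_real (monomial_const p \<alpha>) ^ i)"

lemma mi_size_multiple: "mi_size (\<lambda>j. i * \<alpha> j) = i * mi_size \<alpha>"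
  by (simp add: mi_size_def sum_distrib_left)

lemma multiples_inj:
  assumes "mi_size \<alpha> \<ge> 1"
  shows "(\<lambda>j. i * \<alpha> j) = (\<lambda>j. i' * \<alpha> j) \<longleftrightarrow> i = i'"
proof
  assume "(\<lambda>j. i * \<alpha> j) = (\<lambda>j. i' * \<alpha> j)"
  then have "i * mi_size \<alpha> = i' * mi_size \<alpha>" by (metis mi_size_multiple)
  then show "i = i'" using assms by simp
qed simp

lemma extremal_coeff_multiple:
  assumes "mi_size \<alpha> \<ge> 1" "i \<ge> 1"
  shows "extremal_coeff p \<alpha> (\<lambda>j. i * \<alpha> j) = - 2 * of_real (monomial_const p \<alpha>) ^ i"
proof -
  have "{i'. i' \<ge> 1 \<and> (\<lambda>j. i * \<alpha> j) = (\<lambda>j. i' * \<alpha> j)} = {i}"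
    using assms by (auto simp: multiples_inj)
  then show ?thesis by (simp add: extremal_coeff_def)
qed

lemma extremal_coeff_self:
  "mi_size \<alpha> \<ge> 1 \<Longrightarrow> extremal_coeff p \<alpha> \<alpha> = - 2 * of_real (monomial_const p \<alpha>)"
  using extremal_coeff_multiple[of \<alpha> 1 p] by simp

lemma extremal_coeff_eq_0:
  assumes "mi_size \<beta> = mi_size \<alpha>" "mi_size \<alpha> \<ge> 1" "\<beta> \<noteq> \<alpha>"
  shows "extremal_coeff p \<alpha> \<beta> = 0"
proof -
  have "{i. i \<ge> 1 \<and> \<beta> = (\<lambda>j. i * \<alpha> j)} = {}"
  proof safe
    fix i assume "\<beta> = (\<lambda>j. i * \<alpha> j)"
    then show "i \<in> {}" using assms by (auto simp: mi_size_multiple)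
  qed
  then show ?thesis unfolding extremal_coeff_def by (simp only: sum.empty)
qed

lemma extremal_fun_has_sum:
  assumes p: "1 \<le> p" and \<alpha>: "mi_size \<alpha> \<ge> 1" and z: "z \<in> lp_ball p"
  shows "((\<lambda>\<beta>. extremal_coeff p \<alpha> \<beta> * mi_monom z \<beta>) has_sum extremal_fun p \<alpha> z) UNIV"
proof -
  define w where "w = of_real (monomial_const p \<alpha>) * mi_monom z \<alpha>"
  define m where "m i = (\<lambda>j. i * \<alpha> j)" for i
  have w: "norm w < 1"
    using monomial_const_mult_norm_less_1[OF p z \<alpha>] monomial_const_pos[OF \<alpha>, of p]
    by (simp add: w_def norm_mult)
  have "((\<lambda>i. - 2 * w * w ^ i) has_sum (- 2 * w * (1 / (1 - w)))) UNIV"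
  proof (rule norm_summable_imp_has_sum)
    show "summable (\<lambda>i. norm (- 2 * w * w ^ i))"
      using w by (simp add: norm_mult norm_power summable_mult)
    show "(\<lambda>i. - 2 * w * w ^ i) sums (- 2 * w * (1 / (1 - w)))"
      using geometric_sums[OF w] by (rule sums_mult)
  qed
  also have "(\<lambda>i. - 2 * w * w ^ i) = (\<lambda>i. extremal_coeff p \<alpha> (m (Suc i)) * mi_monom z (m (Suc i)))"
  proof
    fix i
    have "extremal_coeff p \<alpha> (m (Suc i)) = - 2 * of_real (monomial_const p \<alpha>) ^ Suc i"
      unfolding m_def using \<alpha> by (intro extremal_coeff_multiple) auto
    moreover have "mi_monom z (m (Suc i)) = mi_monom z \<alpha> ^ Suc i"
      unfolding mi_monom_def m_def prod_power_distrib by (simp only: power_mult[symmetric] mult.commute)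
    ultimately show "- 2 * w * w ^ i = extremal_coeff p \<alpha> (m (Suc i)) * mi_monom z (m (Suc i))"
      by (simp add: w_def power_mult_distrib mult_ac)
  qed
  also have "(\<dots> has_sum (- 2 * w * (1 / (1 - w)))) UNIV \<longleftrightarrow>
      ((\<lambda>\<beta>. extremal_coeff p \<alpha> \<beta> * mi_monom z \<beta>) has_sum (- 2 * w * (1 / (1 - w)))) (range (\<lambda>i. m (Suc i)))"
    using \<alpha> by (subst has_sum_reindex)
      (auto simp: o_def inj_on_def m_def multiples_inj simp del: mult_Suc)
  also have "\<dots> \<longleftrightarrow>
      ((\<lambda>\<beta>. extremal_coeff p \<alpha> \<beta> * mi_monom z \<beta>) has_sum (- 2 * w * (1 / (1 - w)))) UNIV"
  proof (rule has_sum_cong_neutral)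
    fix \<beta> assume \<beta>: "\<beta> \<in> UNIV - range (\<lambda>i. m (Suc i))"
    have "{i. i \<ge> 1 \<and> \<beta> = (\<lambda>j. i * \<alpha> j)} = {}"
    proof safe
      fix i assume "i \<ge> 1" "\<beta> = (\<lambda>j. i * \<alpha> j)"
      then have "\<beta> = m (Suc (i - 1))" by (simp add: m_def)
      then show "i \<in> {}" using \<beta> by blast
    qed
    then show "extremal_coeff p \<alpha> \<beta> * mi_monom z \<beta> = 0"
      unfolding extremal_coeff_def by (simp only: sum.empty mult_zero_left)
  qed auto
  finally show ?thesis by (simp add: extremal_fun_def w_def Let_def)
qed

lemma rational_on_extremal_fun:
  assumes p: "1 \<le> p" and \<alpha>: "mi_size \<alpha> \<ge> 1"
  shows "rational_on (lp_ball p) (extremal_fun p \<alpha>)"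
proof -
  let ?w = "\<lambda>z. of_real (monomial_const p \<alpha>) * mi_monom z \<alpha>"
  have ne: "1 + (- 1) * ?w z \<noteq> 0" if "z \<in> lp_ball p" for z
  proof
    assume "1 + (- 1) * ?w z = 0"
    then have "norm (?w z) = 1" by simp
    then show False
      using monomial_const_mult_norm_less_1[OF p that \<alpha>] monomial_const_pos[OF \<alpha>, of p]
      by (simp add: norm_mult)
  qed
  have "rational_on (lp_ball p) (\<lambda>z. - 2 * ?w z * inverse (1 + (- 1) * ?w z))"
    using ne by (intro rational_on.intros rational_on_monom)
  then show ?thesis by (simp add: extremal_fun_def[abs_def] divide_inverse Let_def)
qed

lemma extremal_fun_admissible:
  assumes p: "1 \<le> p" and \<alpha>: "mi_size \<alpha> \<ge> 1"
  shows "admissible p (extremal_fun p \<alpha>) (extremal_coeff p \<alpha>) (\<lambda>_. 0)"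
proof -
  note rat = rational_on_extremal_fun[OF p \<alpha>]
  have "holomorphic_Cn_on (lp_ball p) (\<lambda>z :: complex ^ 'a. 0)"
    by (intro rational_on_imp_holomorphic_Cn_on rational_const)
  then have "has_pluriharmonic_expansion_on (lp_ball p) (extremal_fun p \<alpha>) (extremal_coeff p \<alpha>) (\<lambda>_. 0)"
    unfolding has_pluriharmonic_expansion_on_def
    using rational_on_imp_holomorphic_Cn_on[OF rat] extremal_fun_has_sum[OF p \<alpha>]
    by (intro exI[of _ "extremal_fun p \<alpha>"] exI[of _ "\<lambda>_. 0"]) auto
  moreover have "Re (extremal_fun p \<alpha> z) \<le> 1" if "z \<in> lp_ball p" for z
    using Re_neg_cayley_less_1[of "of_real (monomial_const p \<alpha>) * mi_monom z \<alpha>"]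
      monomial_const_mult_norm_less_1[OF p that \<alpha>] monomial_const_pos[OF \<alpha>, of p]
    by (simp add: extremal_fun_def Let_def norm_mult less_imp_le)
  then have "(SUP z\<in>lp_ball p. ereal (Re (extremal_fun p \<alpha> z))) \<le> 1"
    by (intro SUP_least) (simp add: one_ereal_def)
  ultimately show ?thesis
    unfolding admissible_def using rational_on_imp_pluriharmonic_on[OF rat] by blast
qed

lemma extremal_fun_0: "mi_size \<alpha> \<ge> 1 \<Longrightarrow> extremal_fun p \<alpha> 0 = 0"
  using mi_monom_scale[of 0 0 \<alpha>] by (auto simp: extremal_fun_def Let_def power_0_left)

text \<open>
  The part of degree \<open>mi_size \<alpha>\<close> is the single term with index \<open>\<alpha>\<close>, whose modulus comes arbitrarily
  close to \<open>2\<close> on the ball.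
\<close>
lemma extremal_fun_not_homogeneous_bound:
  assumes p: "1 \<le> p" and \<alpha>: "mi_size \<alpha> \<ge> 1" and C: "C < 2"
  shows "\<not> homogeneous_bound C p (mi_size \<alpha>) (extremal_fun p \<alpha>) (extremal_coeff p \<alpha>) (\<lambda>_. 0)"
proof
  assume bound: "homogeneous_bound C p (mi_size \<alpha>) (extremal_fun p \<alpha>) (extremal_coeff p \<alpha>) (\<lambda>_. 0)"
  obtain x where x: "max 0 (C / 2) < x" "x < 1"
    using dense[of "max 0 (C / 2)" 1] C by auto
  define t where "t = root (mi_size \<alpha>) x"
  have t: "0 \<le> t" "t < 1" and tk: "t ^ mi_size \<alpha> = x"
    using x \<alpha> by (simp_all add: t_def)
  obtain z where z: "z \<in> lp_ball p"
    and ext: "of_real (monomial_const p \<alpha>) * mi_monom z \<alpha> = of_real (t ^ mi_size \<alpha>)"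
    using lp_ball_extremal_point[OF p \<alpha> t] by blast
  let ?h = "\<lambda>z. \<Sum>\<beta> | mi_size \<beta> = mi_size \<alpha>. (extremal_coeff p \<alpha> \<beta> + 0) * mi_monom z \<beta>"
  have "?h z = (\<Sum>\<beta>\<in>{\<alpha>}. extremal_coeff p \<alpha> \<beta> * mi_monom z \<beta>)"
    using \<alpha> by (intro sum.mono_neutral_cong_right finite_multi_indices_of_size)
      (auto simp: extremal_coeff_eq_0)
  also have "\<dots> = - 2 * of_real x"
    using ext \<alpha> by (simp add: extremal_coeff_self tk)
  finally have "ereal (2 * x) = ereal (norm (?h z))"
    using x by simp
  also have "\<dots> \<le> (SUP z\<in>lp_ball p. ereal (norm (?h z)))"
    by (rule SUP_upper[OF z])
  also have "\<dots> \<le> ereal (C * (1 - Re (extremal_fun p \<alpha> 0)))"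
    using bound unfolding homogeneous_bound_def .
  finally show False using x by (simp add: extremal_fun_0[OF \<alpha>])
qed

lemma extremal_fun_not_coefficient_bound:
  assumes \<alpha>: "mi_size \<alpha> \<ge> 1" and C: "C < 2"
  shows "\<not> coefficient_bound C p \<alpha> (extremal_fun p \<alpha>) (extremal_coeff p \<alpha>) (\<lambda>_. 0)"
  unfolding coefficient_bound_def monomial_const_def[symmetric]
  using monomial_const_pos[OF \<alpha>, of p] C
  by (simp add: extremal_fun_0[OF \<alpha>] extremal_coeff_self[OF \<alpha>] norm_mult)

lemma ex_multi_index_of_size: "\<exists>\<alpha> :: 'n::finite \<Rightarrow> nat. mi_size \<alpha> = k"
  by (rule exI[of _ "\<lambda>j. if j = undefined then k else 0"]) (simp add: mi_size_def)

section \<open>The sharp estimates\<close>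

theorem theorem2p7:
  fixes p :: ereal
  assumes "1 \<le> p"
  shows
    "(\<forall>(f :: complex ^ 'n \<Rightarrow> complex) a b. admissible p f a b \<longrightarrow>
        (\<forall>k\<ge>1. homogeneous_bound 2 p k f a b) \<and>
        (\<forall>\<alpha>. mi_size \<alpha> \<ge> 1 \<longrightarrow> coefficient_bound 2 p \<alpha> f a b)) \<and>
     (\<forall>k\<ge>1. \<forall>C<2. \<exists>(f :: complex ^ 'n \<Rightarrow> complex) a b.
        admissible p f a b \<and> \<not> homogeneous_bound C p k f a b) \<and>
     (\<forall>\<alpha> :: 'n \<Rightarrow> nat. mi_size \<alpha> \<ge> 1 \<longrightarrow> (\<forall>C<2. \<exists>(f :: complex ^ 'n \<Rightarrow> complex) a b.
        admissible p f a b \<and> \<not> coefficient_bound C p \<alpha> f a b))"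
proof (intro conjI allI impI)
  fix f :: "complex ^ 'n \<Rightarrow> complex" and a b and k :: nat
  assume "admissible p f a b" "k \<ge> 1"
  then show "homogeneous_bound 2 p k f a b" using assms by (intro homogeneous_bound_2)
next
  fix f :: "complex ^ 'n \<Rightarrow> complex" and a b and \<alpha> :: "'n \<Rightarrow> nat"
  assume "admissible p f a b" "mi_size \<alpha> \<ge> 1"
  then show "coefficient_bound 2 p \<alpha> f a b" using assms by (intro coefficient_bound_2)
next
  fix k :: nat and C :: real assume k: "k \<ge> 1" and C: "C < 2"
  obtain \<alpha> :: "'n \<Rightarrow> nat" where \<alpha>: "mi_size \<alpha> = k" using ex_multi_index_of_size by blast
  show "\<exists>(f :: complex ^ 'n \<Rightarrow> complex) a b. admissible p f a b \<and> \<not> homogeneous_bound C p k f a b"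
    using extremal_fun_admissible[OF assms, of \<alpha>] k C
      extremal_fun_not_homogeneous_bound[OF assms, of \<alpha> C] unfolding \<alpha> by blast
next
  fix \<alpha> :: "'n \<Rightarrow> nat" and C :: real assume \<alpha>: "mi_size \<alpha> \<ge> 1" and C: "C < 2"
  show "\<exists>(f :: complex ^ 'n \<Rightarrow> complex) a b. admissible p f a b \<and> \<not> coefficient_bound C p \<alpha> f a b"
    using extremal_fun_admissible[OF assms \<alpha>] extremal_fun_not_coefficient_bound[OF \<alpha> C] by blast
qed

end
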